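(* Let $q$ be an odd prime power and let $\mathcal{S}$ be a special set of the Hermitian surface $\mathsf{H}(3,q^2)$. Then $\mathcal{S}$ is classical; that is, $\mathcal{S}$ is projectively equivalent to the Hermitian Veronesean $$\mathcal{V}=\{(1,x,x^q,x^{q+1}):x\in\mathbb{F}_{q^2}\}\cup\{(0,0,0,1)\}.$$
   Context: Let $q$ be an odd prime power. The Hermitian surface $\mathsf{H}(3,q^2)$ is the polar space in the projective space $\mathrm{PG}(3,q^2)$ defined by the nondegenerate Hermitian form on $\mathbb{F}_{q^2}^4$ $$h(X,Y):=X_0Y_3^q+X_3Y_0^q-X_1Y_1^q-X_2Y_2^q,$$ with coordinates $X=(X_0,X_1,X_2,X_3)$. A point $\langle X\rangle$ of $\mathrm{PG}(3,q^2)$ is singular (i.e. a point of $\mathsf{H}(3,q^2)$) if $h(X,X)=0$. Two singular points $\langle X\rangle,\langle Y\rangle$ are called collinear if $h(X,Y)=0$, equivalently if they lie on a common totally isotropic line. A special set of $\mathsf{H}(3,q^2)$, $q$ odd, is a set $\mathcal{S}$ of $q^2+1$ singular, pairwise non-collinear points such that every singular point $P$ not in $\mathcal{S}$ is collinear with exactly 0 or 2 points of $\mathcal{S}$. Equivalently, it is a set of $q^2+1$ points of $\mathsf{H}(3,q^2)$ such that any three of them span a plane that is nondegenerate with respect to $h$. Vectors in the displayed set $\mathcal{V}$ denote the projective points they span. Projective equivalence to $\mathcal{V}$ means that there is an element of the collineation group $\mathrm{P\Gamma U}(4,q)$ of $\mathsf{H}(3,q^2)$ (the group of collineations of $\mathrm{PG}(3,q^2)$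 preserving $\mathsf{H}(3,q^2)$) mapping $\mathcal{S}$ onto $\mathcal{V}$. *)

theory Defs
  imports "HOL-Analysis.Analysis" "HOL-Number_Theory.Prime_Powers"
begin

text \<open>
  The field of order \<open>q\<^sup>2\<close> is a finite field type \<open>'a\<close> with \<open>CARD('a) = q\<^sup>2\<close>; the definitions below
  that involve the Frobenius map take \<open>q\<close> as a parameter.

  The projective space \<open>PG(3,q\<^sup>2)\<close> is represented inside \<open>'a ^ 4\<close>: points are one-dimensional
  subspaces, and a line is the set of points contained in a two-dimensional subspace.
  Components are numbered from 1, following the library's \<open>vector\<close>, so the homogeneous coordinates
  \<open>(X\<^sub>0, X\<^sub>1, X\<^sub>2, X\<^sub>3)\<close> are \<open>(X $ 1, X $ 2, X $ 3, X $ 4)\<close>.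
\<close>

definition pg_points :: "('a::field ^ 4) set set" where
  "pg_points = {P. vec.subspace P \<and> vec.dim P = 1}"

definition pg_lines :: "('a::field ^ 4) set set set" where
  "pg_lines = {{P \<in> pg_points. P \<subseteq> L} | L. vec.subspace L \<and> vec.dim L = 2}"

definition proj_pt :: "'a::field ^ 4 \<Rightarrow> ('a ^ 4) set" where
  "proj_pt X = vec.span {X}"

definition herm :: "nat \<Rightarrow> 'a::field ^ 4 \<Rightarrow> 'a ^ 4 \<Rightarrow> 'a" where
  "herm q X Y = X $ 1 * (Y $ 4) ^ q + X $ 4 * (Y $ 1) ^ q - X $ 2 * (Y $ 2) ^ q - X $ 3 * (Y $ 3) ^ q"

text \<open>
  Singularity and collinearity are stated for all representatives of the points concerned; the
  lemmas below show that a single choice of representatives suffices.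
\<close>

definition herm_surface :: "nat \<Rightarrow> ('a::field ^ 4) set set" where
  "herm_surface q = {P \<in> pg_points. \<forall>X\<in>P. herm q X X = 0}"

definition herm_collinear :: "nat \<Rightarrow> ('a::field ^ 4) set \<Rightarrow> ('a ^ 4) set \<Rightarrow> bool" where
  "herm_collinear q P Q \<longleftrightarrow> (\<forall>X\<in>P. \<forall>Y\<in>Q. herm q X Y = 0)"

definition special_set :: "nat \<Rightarrow> ('a::field ^ 4) set set \<Rightarrow> bool" where
  "special_set q S \<longleftrightarrow>
     S \<subseteq> herm_surface q \<and> finite S \<and> card S = q\<^sup>2 + 1 \<and>
     (\<forall>P\<in>S. \<forall>Q\<in>S. P \<noteq> Q \<longrightarrow> \<not> herm_collinear q P Q) \<and>
     (\<forall>P \<in> herm_surface q - S. card {Q \<in> S. herm_collinear q P Q} \<in> {0, 2})"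

definition collineation :: "(('a::field ^ 4) set \<Rightarrow> ('a ^ 4) set) \<Rightarrow> bool" where
  "collineation f \<longleftrightarrow> bij_betw f pg_points pg_points \<and> (image f) ` pg_lines = pg_lines"

text \<open>
  The group \<open>P\<Gamma>U(4,q)\<close>, as the collineations that preserve the Hermitian surface. Only the values
  on \<open>pg_points\<close> of its elements matter.
\<close>

definition PGammaU :: "nat \<Rightarrow> (('a::field ^ 4) set \<Rightarrow> ('a ^ 4) set) set" where
  "PGammaU q = {f. collineation f \<and> f ` herm_surface q = herm_surface q}"

definition projectively_equivalent :: "nat \<Rightarrow> ('a::field ^ 4) set set \<Rightarrow> ('a ^ 4) set set \<Rightarrow> bool" where
  "projectively_equivalent q S T \<longleftrightarrow> (\<exists>f \<in> PGammaU q. f ` S = T)"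

definition herm_veronesean :: "nat \<Rightarrow> ('a::field ^ 4) set set" where
  "herm_veronesean q =
     {proj_pt (vector [1, x, x ^ q, x ^ (q + 1)]) | x. True} \<union> {proj_pt (vector [0, 0, 0, 1])}"

lemma vector_4_nth:
  "vector [a, b, c, d] = (v :: 'a::field ^ 4) \<longleftrightarrow> v $ 1 = a \<and> v $ 2 = b \<and> v $ 3 = c \<and> v $ 4 = d"
  by (auto simp: vector_def vec_eq_iff forall_4)

lemma proj_pt_eq: "proj_pt X = {c *s X | c. True}"
  by (auto simp: proj_pt_def vec.span_singleton)

lemma proj_pt_in_pg_points: "X \<noteq> 0 \<Longrightarrow> proj_pt X \<in> pg_points"
  by (simp add: pg_points_def proj_pt_def vec.dim_span vec.dim_eq_card_independent)

lemma pg_points_eq: "pg_points = {proj_pt X | X. X \<noteq> 0}"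
proof -
  have "\<exists>X. P = proj_pt X \<and> X \<noteq> 0" if P: "vec.subspace P" "vec.dim P = 1" for P :: "('a ^ 4) set"
  proof -
    obtain B where B: "B \<subseteq> P" "vec.independent B" "P \<subseteq> vec.span B" "card B = vec.dim P"
      using vec.basis_exists by blast
    then obtain X where X: "B = {X}" using P by (metis card_1_singletonE)
    have "vec.span B = P" using B P by (metis vec.span_minimal subset_antisym)
    then show ?thesis using X B(2) unfolding proj_pt_def
      by (metis insertI1 vec.dependent_zero)
  qed
  then show ?thesis
    using proj_pt_in_pg_points by (auto simp: pg_points_def)
qed

lemma herm_scale: "herm q (c *s X) (d *s Y) = c * d ^ q * herm q X Y"
  by (simp add: herm_def power_mult_distrib algebra_simps)

lemma herm_surface_proj_pt:
  "X \<noteq> 0 \<Longrightarrow> proj_pt X \<in> herm_surface q \<longleftrightarrow> herm q X X = 0"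
  using proj_pt_in_pg_points[of X]
  by (auto simp: herm_surface_def proj_pt_eq herm_scale dest: spec[of _ 1])

lemma herm_collinear_proj_pt:
  "herm_collinear q (proj_pt X) (proj_pt Y) \<longleftrightarrow> herm q X Y = 0"
proof
  assume "herm_collinear q (proj_pt X) (proj_pt Y)"
  then show "herm q X Y = 0"
    unfolding herm_collinear_def proj_pt_def by (meson insertI1 vec.span_base)
next
  assume "herm q X Y = 0"
  then show "herm_collinear q (proj_pt X) (proj_pt Y)"
    by (auto simp: herm_collinear_def proj_pt_eq herm_scale)
qed

end

theory Submission
  imports Defs
begin

text \<open>
  Write \<open>h\<close> for the Hermitian form and \<open>X P\<close> for a vector spanning a point \<open>P\<close> of the special set
  \<open>S\<close>. The proof shows that all Segre invariants of \<open>S\<close> are trivial, and then that this forces \<open>S\<close>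
  to be an elliptic quadric of a Baer subgeometry, which is unique up to similarity.

  The first half is an analogue of Segre's lemma of tangents. Given distinct points \<open>P, Q\<close> of \<open>S\<close>,
  take a singular point \<open>\<langle>R\<rangle>\<close> collinear with both. Every singular point other than \<open>P\<close> on the
  totally isotropic line \<open>\<langle>R, X P\<rangle>\<close> is collinear with \<open>P\<close>, hence with exactly one further point of
  \<open>S\<close>. So the map sending \<open>T\<close> to \<open>h R (X T) / h (X P) (X T)\<close> is a bijection from
  \<open>S - {P}\<close> onto the field, taking \<open>Q\<close> to 0. Multiplying its nonzero values, the product of
  \<open>h R (X T)\<close> over \<open>T \<noteq> P, Q\<close> is a constant times the product of \<open>h (X P) (X T)\<close>. The constant, the
  product of all nonzero field elements, is the same with \<open>P\<close> and \<open>Q\<close> interchanged, so the products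
  of \<open>h (X P) (X T)\<close> and of \<open>h (X Q) (X T)\<close> over \<open>T \<noteq> P, Q\<close> agree (\<open>prod_remaining_eq\<close>). With
  \<open>A P\<close> the product of \<open>h (X P) (X T)\<close> over \<open>T \<noteq> P\<close>, this says that
  \<open>h (X P) (X Q) / h (X Q) (X P) = A P / A Q\<close>. Around a triangle these quotients cancel
  (\<open>segre_invariant_trivial\<close>).

  For the second half fix \<open>E\<close> in \<open>S\<close> and scale all other vectors so that \<open>h (X P) (X E) = 1\<close>. The
  triviality of the invariant of \<open>P, Q, E\<close> now reads \<open>h (X P) (X Q) = h (X Q) (X P)\<close>: all products
  lie in the subfield of order \<open>q\<close>. Fix a second point \<open>Z\<close>. The components \<open>w P\<close> of
  the \<open>X P\<close> orthogonal to \<open>X Z\<close> and \<open>X E\<close> lie in a plane \<open>{a u1 + b u2}\<close> over the subfield,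
  where \<open>u1, u2\<close> are orthogonal (\<open>orthogonal_basis\<close>). Choose \<open>z\<close> with
  \<open>z\<^sup>2 = - h u2 u2 / h u1 u1\<close>, an element of the subfield, so that \<open>z ^ q = \<plusminus> z\<close>. Distinct
  \<open>w P, w Q\<close> have an anisotropic difference, so if \<open>z\<close> were in the subfield then \<open>a + b z\<close> would distinguish \<open>q\<^sup>2\<close> points by \<open>q\<close> values; hence \<open>z ^ q = - z\<close>. Then
  \<open>a u1 + b u2 = x f1 + x ^ q f2\<close> for \<open>x = a + b z\<close> and two orthogonal vectors \<open>f1, f2\<close> of equal
  norm, and the linear map taking the standard basis to \<open>X Z, f1, f2\<close> and a multiple of \<open>X E\<close> is a
  similarity of \<open>h\<close> that maps the Hermitian Veronesean onto \<open>S\<close> (\<open>similarity_from_veronesean\<close>).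
\<close>

section \<open>Finite fields\<close>

lemma card_power_fibre_le:
  fixes c :: "'a::idom"
  assumes "n > 0"
  shows "card {x. x ^ n = c} \<le> n"
proof -
  let ?p = "Polynomial.monom 1 n + [:- c:]"
  have deg: "degree ?p = n"
    using assms by (simp add: degree_add_eq_left degree_monom_eq)
  then have "?p \<noteq> 0"
    using assms by force
  from card_poly_roots_bound[OF this] show ?thesis
    by (simp add: deg poly_monom)
qed

lemma power_card_minus_1_eq_1:
  fixes x :: "'a::{field,finite}"
  assumes "x \<noteq> 0"
  shows "x ^ (CARD('a) - 1) = 1"
proof -
  have "bij_betw ((*) x) (UNIV - {0}) (UNIV - {0})"
    using assms by (intro bij_betwI[of _ _ _ "\<lambda>y. y / x"]) auto
  from prod.reindex_bij_betw[OF this, of id]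
  have "(\<Prod>y\<in>UNIV - {0}. x * y) = \<Prod>(UNIV - {0})"
    by simp
  then have "x ^ card (UNIV - {0::'a}) * \<Prod>(UNIV - {0}) = \<Prod>(UNIV - {0})"
    by (simp add: prod.distrib)
  moreover have "\<Prod>(UNIV - {0::'a}) \<noteq> 0"
    by simp
  ultimately show ?thesis
    by (simp add: card_Diff_singleton)
qed

text \<open>
  On the \<open>a * b\<close> nonzero elements the map \<open>x \<mapsto> x ^ a\<close> has fibres of size at most \<open>a\<close>, so at least \<open>b\<close>
  values, and all of them are among the at most \<open>b\<close> roots of \<open>z ^ b = 1\<close>. In a field of order \<open>q\<^sup>2\<close>,
  \<open>a = q + 1\<close> makes the norm surjective onto the subfield of order \<open>q\<close>, and \<open>a = 2\<close> gives square
  roots of the elements of that subfield.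
\<close>
lemma power_surj_on_roots_of_unity:
  fixes y :: "'a::{field,finite}"
  assumes card: "a * b = CARD('a) - 1" and y: "y ^ b = 1"
  shows "\<exists>x. x ^ a = y"
proof -
  have "CARD('a) \<ge> 2"
    using card_mono[of UNIV "{0, 1 :: 'a}"] by simp
  with card have pos: "a > 0" "b > 0"
    by (auto intro: Nat.gr0I)
  let ?U = "UNIV - {0 :: 'a}" and ?Z = "{z :: 'a. z ^ b = 1}"
  let ?I = "(\<lambda>x. x ^ a) ` ?U"
  have sub: "?I \<subseteq> ?Z"
    using card power_card_minus_1_eq_1 by (auto simp flip: power_mult)
  have "a * b = card ?U"
    by (simp add: card card_Diff_singleton)
  also have "\<dots> \<le> card (\<Union>z\<in>?I. {x. x ^ a = z})"
    by (intro card_mono) auto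
  also have "\<dots> \<le> (\<Sum>z\<in>?I. card {x :: 'a. x ^ a = z})"
    by (intro card_UN_le) simp
  also have "\<dots> \<le> card ?I * a"
    using sum_bounded_above[of ?I "\<lambda>z. card {x. x ^ a = z}" a, OF card_power_fibre_le[OF pos(1)]]
    by (simp only: of_nat_id)
  finally have "b \<le> card ?I"
    using pos by (simp add: mult.commute)
  moreover have "card ?Z \<le> b"
    using card_power_fibre_le pos by blast
  ultimately have "?I = ?Z"
    using sub by (intro card_seteq) auto
  moreover have "y \<in> ?Z"
    using y by simp
  ultimately have "y \<in> ?I"
    by simp
  then show ?thesis
    by blast
qed

text \<open>
  Translation by 1 permutes the field, so it does not change the sum of all elements.
\<close>
lemma of_nat_card_eq_0: "(of_nat CARD('a) :: 'a::{field,finite}) = 0"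
proof -
  have "bij_betw (\<lambda>y :: 'a. y + 1) UNIV UNIV"
    by (intro bij_betwI[of _ _ _ "\<lambda>y. y - 1"]) auto
  from sum.reindex_bij_betw[OF this, of "\<lambda>y. y"] show ?thesis
    by (simp add: sum.distrib)
qed

text \<open>
  The Frobenius power \<open>x ^ q\<close> is the conjugation of the field of order \<open>q\<^sup>2\<close>; the elements with
  \<open>x ^ q = x\<close> form the subfield of order \<open>q\<close>, called the fixed field below.
\<close>
locale hermitian_geometry =
  fixes q :: nat and field_type :: "'a::{field,finite} itself"
  assumes primepow_q: "primepow q" and odd_q: "odd q" and card_field: "CARD('a) = q\<^sup>2"
begin

lemma q_gt_1: "q > 1"
  using primepow_gt_Suc_0[OF primepow_q] by simp

lemma zero_power_q [simp]: "(0 :: 'a) ^ q = 0"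
  using q_gt_1 by simp

lemma prime_char: "prime CHAR('a)" and q_power_of_char: "\<exists>n. q = CHAR('a) ^ n"
proof -
  show "prime CHAR('a)"
    by (intro prime_CHAR_semidom finite_imp_CHAR_pos) simp
  obtain p n where pn: "prime p" "q = p ^ n"
    using primepow_q by (auto simp: primepow_def)
  have "CHAR('a) dvd q\<^sup>2"
    using of_nat_card_eq_0 of_nat_eq_0_iff_char_dvd[where ?'a = 'a] card_field by metis
  then have "CHAR('a) dvd p"
    using \<open>prime CHAR('a)\<close> pn by (auto dest: prime_dvd_power)
  then show "\<exists>n. q = CHAR('a) ^ n"
    using \<open>prime CHAR('a)\<close> pn primes_dvd_imp_eq by blast
qed

lemma conj_add: "(x + y :: 'a) ^ q = x ^ q + y ^ q"
  using freshmans_dream' prime_char q_power_of_char by blast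

lemma conj_minus: "(- x :: 'a) ^ q = - (x ^ q)"
  using odd_q by simp

lemma conj_diff: "(x - y :: 'a) ^ q = x ^ q - y ^ q"
  using conj_add[of x "- y"] by (simp add: conj_minus)

lemma conj_conj [simp]: "((x :: 'a) ^ q) ^ q = x"
proof (cases "x = 0")
  case False
  have "(x ^ q) ^ q = x * x ^ (CARD('a) - 1)"
    using q_gt_1 by (simp add: card_field power2_eq_square flip: power_mult power_Suc)
  then show ?thesis
    using power_card_minus_1_eq_1[OF False] by simp
qed (use q_gt_1 in simp)

lemma conj_of_nat [simp]: "(of_nat n :: 'a) ^ q = of_nat n"
  using q_gt_1 by (induction n) (simp_all add: conj_add)

lemma conj_numeral [simp]: "(numeral n :: 'a) ^ q = numeral n"
  using conj_of_nat[of "numeral n"] by simp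

lemma two_neq_0 [simp]: "(2 :: 'a) \<noteq> 0"
proof
  assume "(2 :: 'a) = 0"
  then have "CHAR('a) dvd 2"
    using of_nat_eq_0_iff_char_dvd[where ?'a = 'a, of 2] by simp
  then have "CHAR('a) = 2"
    using prime_char primes_dvd_imp_eq two_is_prime_nat by blast
  then show False
    using q_power_of_char odd_q q_gt_1 by auto
qed

lemma card_fixed_field: "card {x :: 'a. x ^ q = x} \<le> q"
proof -
  have "{x :: 'a. x ^ q = x} \<subseteq> insert 0 {x. x ^ (q - 1) = 1}"
  proof
    fix x :: 'a assume "x \<in> {x. x ^ q = x}"
    moreover have "x ^ q = x * x ^ (q - 1)"
      using q_gt_1 by (simp flip: power_Suc)
    ultimately show "x \<in> insert 0 {x. x ^ (q - 1) = 1}"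
      by auto
  qed
  then have "card {x :: 'a. x ^ q = x} \<le> card (insert 0 {x :: 'a. x ^ (q - 1) = 1})"
    by (intro card_mono) auto
  also have "\<dots> \<le> Suc (q - 1)"
    using card_power_fibre_le[of "q - 1" "1 :: 'a"] q_gt_1 card_insert_le_m1
    by (intro order.trans[OF card_insert_le_m1]) auto
  finally show ?thesis
    using q_gt_1 by simp
qed

lemma fixed_power_eq_1:
  assumes "(y :: 'a) ^ q = y" "y \<noteq> 0"
  shows "y ^ (q - 1) = 1"
proof -
  have "y * y ^ (q - 1) = y"
    using q_gt_1 assms by (simp flip: power_Suc)
  then show ?thesis
    using assms by simp
qed

lemma norm_surj:
  assumes "(y :: 'a) ^ q = y"
  shows "\<exists>x. x * x ^ q = y"
proof (cases "y = 0")
  case False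
  have "(q + 1) * (q - 1) = CARD('a) - 1"
    by (simp add: card_field power2_eq_square algebra_simps)
  then show ?thesis
    using power_surj_on_roots_of_unity fixed_power_eq_1[OF assms False] by fastforce
qed auto

lemma fixed_is_square:
  assumes "(y :: 'a) ^ q = y"
  shows "\<exists>x. x\<^sup>2 = y"
proof (cases "y = 0")
  case False
  obtain k where k: "q + 1 = 2 * k"
    using odd_q by (metis dvd_def even_Suc Suc_eq_plus1)
  have "2 * ((q - 1) * k) = (q + 1) * (q - 1)"
    unfolding k by simp
  also have "\<dots> = CARD('a) - 1"
    by (simp add: card_field power2_eq_square algebra_simps)
  finally have "2 * ((q - 1) * k) = CARD('a) - 1" .
  then show ?thesis
    by (rule power_surj_on_roots_of_unity)
       (simp only: power_mult fixed_power_eq_1[OF assms False] power_one)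
qed (auto intro: exI[of _ 0])

section \<open>The Hermitian form\<close>

abbreviation h :: "'a ^ 4 \<Rightarrow> 'a ^ 4 \<Rightarrow> 'a" where "h \<equiv> herm q"

lemma h_simps:
  "h (X + Y) Z = h X Z + h Y Z" "h X (Y + Z) = h X Y + h X Z"
  "h (X - Y) Z = h X Z - h Y Z" "h X (Y - Z) = h X Y - h X Z"
  "h (c *s X) Y = c * h X Y" "h X (c *s Y) = c ^ q * h X Y"
  "h 0 X = 0" "h X 0 = 0"
  by (simp_all add: herm_def conj_add conj_diff power_mult_distrib algebra_simps)

lemma h_conj: "h Y X = (h X Y) ^ q"
  by (simp add: herm_def conj_add conj_diff power_mult_distrib algebra_simps)

lemma h_eq_0_commute: "h X Y = 0 \<longleftrightarrow> h Y X = 0"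
  by (metis h_conj zero_power_q)

lemma h_self_fixed: "(h X X) ^ q = h X X"
  by (metis h_conj)

lemma h_nondegenerate:
  assumes "\<And>Y. h X Y = 0"
  shows "X = 0"
proof -
  have "h X (axis i 1) = 0" for i
    by (rule assms)
  from this[of 1] this[of 2] this[of 3] this[of 4] show ?thesis
    by (simp add: herm_def axis_def vec_eq_iff forall_4)
qed

text \<open>
  Fewer than four linear conditions on \<open>'a ^ 4\<close> have a common nonzero solution, because there are
  more vectors than possible triples of values.
\<close>
lemma exists_orthogonal_to_three: "\<exists>Z. Z \<noteq> 0 \<and> h Z A = 0 \<and> h Z B = 0 \<and> h Z C = 0"
proof -
  let ?F = "\<lambda>Z. (h Z A, h Z B, h Z C)"
  have "CARD('a) > 1"
    using one_less_power[OF q_gt_1, of 2] card_field by simp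
  then have "CARD('a) ^ 3 < CARD('a) ^ 4"
    by (intro power_strict_increasing) simp_all
  moreover have "CARD('a \<times> 'a \<times> 'a) = CARD('a) ^ 3" and "CARD('a ^ 4) = CARD('a) ^ 4"
    by (simp_all add: power3_eq_cube)
  ultimately have "CARD('a \<times> 'a \<times> 'a) < CARD('a ^ 4)"
    by simp
  then have "\<not> inj ?F"
    using card_inj_on_le[of ?F UNIV UNIV] by (meson finite not_le subset_UNIV)
  then obtain X Y where "?F X = ?F Y" "X \<noteq> Y"
    by (meson injI)
  then show ?thesis
    by (intro exI[of _ "X - Y"]) (simp add: h_simps)
qed

text \<open>
  The orthogonal complement of two vectors contains two independent orthogonal vectors \<open>U, V\<close>. If
  neither is isotropic, then \<open>a *s U + V\<close> is as soon as the norm of \<open>a\<close> is \<open>- h V V / h U U\<close>, which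
  can be arranged because that quotient is fixed by conjugation.
\<close>
lemma exists_isotropic_orthogonal_to_two: "\<exists>R. R \<noteq> 0 \<and> h R R = 0 \<and> h R A = 0 \<and> h R B = 0"
proof -
  obtain U where U: "U \<noteq> 0" "h U A = 0" "h U B = 0"
    using exists_orthogonal_to_three[of A B B] by blast
  obtain V where V: "V \<noteq> 0" "h V A = 0" "h V B = 0" "h V U = 0"
    using exists_orthogonal_to_three[of A B U] by blast
  show ?thesis
  proof (cases "h U U = 0 \<or> h V V = 0")
    case True
    then show ?thesis using U V by blast
  next
    case False
    have "(- h V V / h U U) ^ q = - h V V / h U U"
      by (simp add: power_divide conj_minus h_self_fixed)
    then obtain a where a: "a * a ^ q = - h V V / h U U"
      using norm_surj by blast
    have "h U V = 0"
      using V h_eq_0_commute by blast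
    then have "h (a *s U + V) (a *s U + V) = (a * a ^ q) * h U U + h V V"
      using V by (simp add: h_simps)
    also have "\<dots> = 0"
      using False by (simp add: a)
    finally have "h (a *s U + V) (a *s U + V) = 0" .
    moreover have "h (a *s U + V) V \<noteq> 0"
      using False \<open>h U V = 0\<close> by (simp add: h_simps)
    then have "a *s U + V \<noteq> 0"
      by (rule contrapos_nn) (simp only: h_simps(7))
    ultimately show ?thesis
      using U V by (intro exI[of _ "a *s U + V"]) (simp add: h_simps)
  qed
qed

section \<open>Similarities of the form act on the projective space\<close>

definition similarity :: "('a ^ 4 \<Rightarrow> 'a ^ 4) \<Rightarrow> bool" where
  "similarity T \<longleftrightarrow> Vector_Spaces.linear (*s) (*s) T \<and> (\<exists>m. m \<noteq> 0 \<and> (\<forall>X Y. h (T X) (T Y) = m * h X Y))"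

lemma similarity_bij:
  assumes "similarity T"
  shows "bij T"
proof -
  obtain m where m: "m \<noteq> 0" "\<And>X Y. h (T X) (T Y) = m * h X Y"
    using assms unfolding similarity_def by blast
  have lin: "Vector_Spaces.linear (*s) (*s) T"
    using assms unfolding similarity_def by blast
  have "X = 0" if "T X = 0" for X
  proof (rule h_nondegenerate)
    fix Y
    have "m * h X Y = h 0 (T Y)"
      by (simp only: m(2)[symmetric] that)
    then show "h X Y = 0"
      using m(1) by (simp add: h_simps)
  qed
  then have "inj T"
    using vec.linear_inj_iff_eq_0[OF lin] by blast
  then show ?thesis
    by (simp add: bij_def finite_UNIV_inj_surj)
qed

lemma similarity_inv:
  assumes "similarity T"
  shows "similarity (inv T)"
proof -
  obtain m where m: "m \<noteq> 0" "\<And>X Y. h (T X) (T Y) = m * h X Y"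
    using assms unfolding similarity_def by blast
  have lin: "Vector_Spaces.linear (*s) (*s) T"
    using assms unfolding similarity_def by blast
  note bij = similarity_bij[OF assms]
  have T_inv: "T (inv T X) = X" for X
    using bij by (simp add: bij_is_surj surj_f_inv_f)
  have inv_T: "inv T (T X) = X" for X
    using bij by (simp add: bij_is_inj)
  have "Vector_Spaces.linear (*s) (*s) (inv T)"
  proof (unfold Vector_Spaces.linear_iff, intro conjI allI vec.vector_space_axioms)
    show "inv T (X + Y) = inv T X + inv T Y" for X Y
      by (metis T_inv inv_T vec.linear_add[OF lin])
    show "inv T (c *s X) = c *s inv T X" for c X
      by (metis T_inv inv_T vec.linear_scale[OF lin])
  qed
  moreover have "h (inv T X) (inv T Y) = inverse m * h X Y" for X Y
    using m(1) m(2)[of "inv T X" "inv T Y"] by (simp add: T_inv)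
  ultimately show ?thesis
    unfolding similarity_def using m(1) by (intro conjI exI[of _ "inverse m"]) auto
qed

lemma similarity_image_proj_pt:
  assumes "similarity T"
  shows "T ` proj_pt X = proj_pt (T X)"
proof -
  have "Vector_Spaces.linear (*s) (*s) T"
    using assms unfolding similarity_def by blast
  then show ?thesis
    unfolding proj_pt_def by (simp add: vec.linear_span_image[symmetric])
qed

lemma similarity_image_subspace:
  assumes "similarity T" "vec.subspace L"
  shows "vec.subspace (T ` L) \<and> vec.dim (T ` L) = vec.dim L"
proof -
  have lin: "Vector_Spaces.linear (*s) (*s) T"
    using assms unfolding similarity_def by blast
  have "inj_on T (vec.span L)"
    using similarity_bij[OF assms(1)] by (meson bij_is_inj inj_on_subset subset_UNIV)
  then show ?thesis
    using vec.linear_subspace_image[OF lin assms(2)] vec.dim_image_eq[OF lin] by blast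
qed

text \<open>
  A similarity and its inverse both preserve dimensions of subspaces and isotropy of vectors, so each
  inclusion needed here comes with its converse.
\<close>
lemma similarity_image_in_PGammaU:
  assumes "similarity T"
  shows "image T \<in> PGammaU q"
proof -
  have bij: "bij U" if "similarity U" for U
    using similarity_bij that .
  have cancel: "inv T ` T ` A = A" "T ` inv T ` A = A" for A
    using bij[OF assms] by (auto simp: image_image bij_is_inj bij_is_surj surj_f_inv_f)
  have pts: "U ` P \<in> pg_points" if "similarity U" "P \<in> pg_points" for U P
    using similarity_image_subspace that unfolding pg_points_def by simp
  have bij_pts: "bij_betw (image T) pg_points pg_points"
    using pts[OF assms] pts[OF similarity_inv[OF assms]] cancel
    by (intro bij_betwI[of _ _ _ "image (inv T)"]) auto
  have line: "image T ` {P \<in> pg_points. P \<subseteq> L} = {P \<in> pg_points. P \<subseteq> T ` L}" for L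
  proof
    show "image T ` {P \<in> pg_points. P \<subseteq> L} \<subseteq> {P \<in> pg_points. P \<subseteq> T ` L}"
      using pts[OF assms] by auto
    show "{P \<in> pg_points. P \<subseteq> T ` L} \<subseteq> image T ` {P \<in> pg_points. P \<subseteq> L}"
    proof
      fix P assume P: "P \<in> {P \<in> pg_points. P \<subseteq> T ` L}"
      then have "inv T ` P \<subseteq> inv T ` T ` L"
        by blast
      then have "inv T ` P \<in> {P \<in> pg_points. P \<subseteq> L}"
        using P pts[OF similarity_inv[OF assms]] by (simp add: cancel)
      then show "P \<in> image T ` {P \<in> pg_points. P \<subseteq> L}"
        using cancel(2)[of P] by (metis (no_types, lifting) imageI)
    qed
  qed
  have lines: "image (image T) ` pg_lines = pg_lines"
  proof
    show "image (image T) ` pg_lines \<subseteq> pg_lines"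
    proof
      fix m :: "('a ^ 4) set set" assume "m \<in> image (image T) ` pg_lines"
      then obtain L :: "('a ^ 4) set" where L: "vec.subspace L" "vec.dim L = 2" "m = image T ` {P \<in> pg_points. P \<subseteq> L}"
        unfolding pg_lines_def by blast
      then show "m \<in> pg_lines"
        unfolding pg_lines_def using line[of L] similarity_image_subspace[OF assms L(1)] by auto
    qed
    show "pg_lines \<subseteq> image (image T) ` pg_lines"
    proof
      fix m :: "('a ^ 4) set set" assume "m \<in> pg_lines"
      then obtain L :: "('a ^ 4) set" where L: "vec.subspace L" "vec.dim L = 2" "m = {P \<in> pg_points. P \<subseteq> L}"
        unfolding pg_lines_def by blast
      have "m = image T ` {P \<in> pg_points. P \<subseteq> inv T ` L}"
        using line[of "inv T ` L"] by (simp add: L(3) cancel)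
      moreover have "{P \<in> pg_points. P \<subseteq> inv T ` L} \<in> pg_lines"
        unfolding pg_lines_def
        using similarity_image_subspace[OF similarity_inv[OF assms] L(1)] L(2) by auto
      ultimately show "m \<in> image (image T) ` pg_lines"
        by blast
    qed
  qed
  have surface: "U ` P \<in> herm_surface q" if U: "similarity U" and P: "P \<in> herm_surface q" for U P
  proof -
    obtain m where m: "\<And>X Y. h (U X) (U Y) = m * h X Y"
      using U unfolding similarity_def by blast
    show ?thesis
      using P pts[OF U, of P] unfolding herm_surface_def by (simp add: m)
  qed
  have "image T ` herm_surface q = herm_surface q"
  proof
    show "image T ` herm_surface q \<subseteq> herm_surface q"
      using surface[OF assms] by blast
    show "herm_surface q \<subseteq> image T ` herm_surface q"
      using surface[OF similarity_inv[OF assms]] cancel(2) by (metis imageI subsetI)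
  qed
  then show ?thesis
    unfolding PGammaU_def collineation_def using bij_pts lines by blast
qed

lemma projectively_equivalentI:
  assumes "similarity T" "image T ` A = B"
  shows "projectively_equivalent q B A"
proof -
  have "inv T ` T ` P = P" for P
    using similarity_bij[OF assms(1)] by (auto simp: image_image bij_is_inj)
  then have "image (inv T) ` B = A"
    by (simp add: assms(2)[symmetric] image_image)
  then show ?thesis
    unfolding projectively_equivalent_def
    using similarity_image_in_PGammaU[OF similarity_inv[OF assms(1)]] by blast
qed

section \<open>Orthogonal frames\<close>

definition frame_map :: "'a ^ 4 \<Rightarrow> 'a ^ 4 \<Rightarrow> 'a ^ 4 \<Rightarrow> 'a ^ 4 \<Rightarrow> 'a ^ 4 \<Rightarrow> 'a ^ 4" where
  "frame_map A B C D v = v $ 1 *s A + v $ 2 *s B + v $ 3 *s C + v $ 4 *s D"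

lemma linear_frame_map: "Vector_Spaces.linear (*s) (*s) (frame_map A B C D)"
proof (unfold Vector_Spaces.linear_iff, intro conjI allI vec.vector_space_axioms)
  show "frame_map A B C D (X + Y) = frame_map A B C D X + frame_map A B C D Y" for X Y
    by (simp add: frame_map_def vec_eq_iff algebra_simps)
  show "frame_map A B C D (c *s X) = c *s frame_map A B C D X" for c X
    by (simp add: frame_map_def vec_eq_iff algebra_simps)
qed

text \<open>
  The hypotheses say that the Gram matrix of \<open>A, B, C, m *s D\<close> is \<open>m\<close> times the matrix of \<open>h\<close> in the
  standard basis.
\<close>
lemma similarity_frame_map:
  assumes "h A A = 0" "h D D = 0" "h A D = 1" "h D A = 1"
    and "h A B = 0" "h A C = 0" "h D B = 0" "h D C = 0"
    and "h B A = 0" "h C A = 0" "h B D = 0" "h C D = 0"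
    and "h B C = 0" "h C B = 0" "h B B = - m" "h C C = - m"
    and "m ^ q = m" "m \<noteq> 0"
  shows "similarity (frame_map A B C (m *s D))"
proof -
  have "h (frame_map A B C (m *s D) X) (frame_map A B C (m *s D) Y) = m * h X Y" for X Y
  proof -
    have "h (frame_map A B C (m *s D) X) (frame_map A B C (m *s D) Y) =
        X $ 1 * (Y $ 4 ^ q * m) + X $ 4 * m * Y $ 1 ^ q - X $ 2 * Y $ 2 ^ q * m - X $ 3 * Y $ 3 ^ q * m"
      unfolding frame_map_def
      by (simp add: h_simps assms(1-17) power_mult_distrib)
    also have "\<dots> = m * h X Y"
      unfolding herm_def by (simp add: algebra_simps)
    finally show ?thesis .
  qed
  then show ?thesis
    unfolding similarity_def using linear_frame_map assms by blast
qed

text \<open>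
  Here \<open>A, D\<close> is a hyperbolic pair, and \<open>B\<close> and \<open>C\<close> are orthogonal to it and to each other. Pairing a
  vanishing linear combination with \<open>A, B, D\<close> kills three coefficients, and then the fourth vanishes because
  \<open>C\<close> is nonzero. The next lemma applies this to an isotropic \<open>C\<close>, to reach a contradiction.
\<close>
lemma frame_map_surj:
  assumes "h A A = 0" "h D D = 0" "h A D = 1" "h D A = 1"
    and "h B A = 0" "h C A = 0" "h B D = 0" "h C D = 0" "h A B = 0" "h D B = 0"
    and "h C B = 0" "h B B \<noteq> 0" "C \<noteq> 0"
  shows "surj (frame_map A B C D)"
proof -
  have "v = 0" if v: "frame_map A B C D v = 0" for v
  proof -
    have "h (frame_map A B C D v) Z = 0" for Z
      by (simp add: v h_simps)
    from this[of A] this[of B] this[of D] have zero: "v $ 1 = 0" "v $ 2 = 0" "v $ 4 = 0"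
      unfolding frame_map_def by (simp_all add: h_simps assms(1-12))
    have "v $ 3 *s C = 0"
      using v by (simp add: frame_map_def zero)
    then have "v $ 3 = 0"
      using assms(13) by (simp add: vector_mul_eq_0)
    then show "v = 0"
      using zero by (simp add: vec_eq_iff forall_4)
  qed
  then have "inj (frame_map A B C D)"
    using vec.linear_inj_iff_eq_0[OF linear_frame_map] by blast
  then show ?thesis
    by (simp add: finite_UNIV_inj_surj)
qed

text \<open>
  If \<open>C\<close> were isotropic, it would be orthogonal to a spanning set, against nondegeneracy.
\<close>
lemma orthogonal_complement_anisotropic:
  assumes "h A A = 0" "h D D = 0" "h A D = 1" "h D A = 1"
    and "h B A = 0" "h C A = 0" "h B D = 0" "h C D = 0" "h A B = 0" "h D B = 0"
    and "h C B = 0" "h B B \<noteq> 0" "C \<noteq> 0"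
  shows "h C C \<noteq> 0"
proof
  assume CA: "h C C = 0"
  have "h C Y = 0" for Y
  proof -
    obtain v where "Y = frame_map A B C D v"
      using frame_map_surj[OF assms] by (auto simp: surj_def)
    then show ?thesis
      using CA by (simp add: frame_map_def h_simps assms(6,8,11))
  qed
  then show False
    using h_nondegenerate[of C] assms(13) by blast
qed

lemma orthogonal_expansion:
  assumes "h A A = 0" "h D D = 0" "h A D = 1" "h D A = 1"
    and "h B A = 0" "h C A = 0" "h B D = 0" "h C D = 0" "h A B = 0" "h D B = 0"
    and "h C B = 0" "h B B \<noteq> 0" "C \<noteq> 0"
    and "h B C = 0" "h A C = 0" "h D C = 0" and "h W A = 0" "h W D = 0"
  shows "W = (h W B / h B B) *s B + (h W C / h C C) *s C"
proof -
  obtain v where v: "W = frame_map A B C D v"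
    using frame_map_surj[OF assms(1-13)] by (auto simp: surj_def)
  have "h W A = v $ 4" "h W D = v $ 1" "h W B = v $ 2 * h B B" "h W C = v $ 3 * h C C"
    unfolding v frame_map_def by (simp_all add: h_simps assms(1-11,14-16))
  then have coeffs: "v $ 1 = 0" "v $ 4 = 0" "v $ 2 = h W B / h B B" "v $ 3 = h W C / h C C"
    using assms(12,17,18) orthogonal_complement_anisotropic[OF assms(1-13)] by simp_all
  have "W = v $ 1 *s A + v $ 2 *s B + v $ 3 *s C + v $ 4 *s D"
    using v by (simp only: frame_map_def)
  also have "\<dots> = (h W B / h B B) *s B + (h W C / h C C) *s C"
    by (simp only: coeffs) simp
  finally show ?thesis .
qed

end

section \<open>Segre invariants of a special set\<close>

text \<open>
  The triviality of the Segre invariant does not depend on the vectors chosen for the points, so it is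
  proved for an arbitrary choice \<open>X\<close>, and later applied to a normalised one.
\<close>
locale special_set_representatives = hermitian_geometry q field_type
  for q :: nat and field_type :: "'a::{field,finite} itself" +
  fixes S :: "('a ^ 4) set set" and X :: "('a ^ 4) set \<Rightarrow> 'a ^ 4"
  assumes special: "special_set q S"
    and X_nonzero: "P \<in> S \<Longrightarrow> X P \<noteq> 0"
    and proj_pt_X: "P \<in> S \<Longrightarrow> proj_pt (X P) = P"
begin

lemma S_subset: "S \<subseteq> herm_surface q"
  and finite_S [simp]: "finite S"
  and card_S: "card S = q\<^sup>2 + 1"
  and S_not_collinear: "\<forall>P\<in>S. \<forall>Q\<in>S. P \<noteq> Q \<longrightarrow> \<not> herm_collinear q P Q"
  and S_zero_or_two: "\<forall>P\<in>herm_surface q - S. card {Q \<in> S. herm_collinear q P Q} \<in> {0, 2}"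
  using special unfolding special_set_def by - (elim conjE, assumption)+

lemma X_isotropic:
  assumes "P \<in> S"
  shows "h (X P) (X P) = 0"
proof -
  have "proj_pt (X P) \<in> herm_surface q"
    unfolding proj_pt_X[OF assms] using S_subset assms by (rule subsetD)
  then show ?thesis
    by (simp only: herm_surface_proj_pt[OF X_nonzero[OF assms]])
qed

lemma herm_collinear_iff:
  assumes "Q \<in> S"
  shows "herm_collinear q (proj_pt Y) Q \<longleftrightarrow> h Y (X Q) = 0"
  using herm_collinear_proj_pt[of q Y "X Q"] by (simp only: proj_pt_X[OF assms])

lemma X_not_orthogonal:
  assumes "P \<in> S" "Q \<in> S" "P \<noteq> Q"
  shows "h (X P) (X Q) \<noteq> 0"
proof -
  have "\<not> herm_collinear q P Q"
    using S_not_collinear assms by blast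
  then show ?thesis
    using herm_collinear_iff[OF assms(2), of "X P"] unfolding proj_pt_X[OF assms(1)] by blast
qed

lemma card_orthogonal_in_S:
  assumes "Y \<noteq> 0" "h Y Y = 0" "proj_pt Y \<notin> S"
  shows "card {Q \<in> S. h Y (X Q) = 0} \<in> {0, 2}"
proof -
  have "proj_pt Y \<in> herm_surface q - S"
    using assms by (simp add: herm_surface_proj_pt)
  then have "card {Q \<in> S. herm_collinear q (proj_pt Y) Q} \<in> {0, 2}"
    using S_zero_or_two by (rule bspec[rotated])
  moreover have "{Q \<in> S. herm_collinear q (proj_pt Y) Q} = {Q \<in> S. h Y (X Q) = 0}"
    by (intro Collect_cong conj_cong refl herm_collinear_iff)
  ultimately show ?thesis
    by (simp only:)
qed

text \<open>
  The value \<open>t\<close> at \<open>T\<close> marks the point \<open>\<langle>R - t X P\<rangle>\<close> of the line \<open>\<langle>R, X P\<rangle>\<close> that is collinear with \<open>T\<close>.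
  This point is singular, collinear with \<open>P\<close> and outside \<open>S\<close>, so of the numbers 0 and 2 of collinear
  points of \<open>S\<close> only 2 is possible: besides \<open>P\<close> there is exactly one \<open>T\<close> for each \<open>t\<close>.
\<close>
lemma bij_betw_tangent_line:
  assumes P: "P \<in> S" and Q: "Q \<in> S" and "P \<noteq> Q"
    and R: "R \<noteq> 0" "h R R = 0" "h R (X P) = 0" "h R (X Q) = 0"
  shows "bij_betw (\<lambda>T. h R (X T) / h (X P) (X T)) (S - {P}) UNIV"
proof -
  have two: "card {T \<in> S. h (R - t *s X P) (X T) = 0} = 2" for t
  proof -
    let ?Y = "R - t *s X P"
    have PQ: "h (X P) (X Q) \<noteq> 0"
      using X_not_orthogonal P Q \<open>P \<noteq> Q\<close> by blast
    have PR: "h (X P) R = 0"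
      using R(3) by (rule h_eq_0_commute[THEN iffD1])
    \<comment> \<open>In particular the point \<open>\<langle>?Y\<rangle>\<close> is not \<open>P\<close>; pairing with \<open>X Q\<close> shows that \<open>R\<close> would vanish otherwise.\<close>
    have not_multiple: "R - t *s X P \<noteq> c *s X P" for c
    proof
      assume eq: "R - t *s X P = c *s X P"
      have "h (R - t *s X P) (X Q) = h (c *s X P) (X Q)"
        by (simp only: eq)
      then have "c * h (X P) (X Q) = - t * h (X P) (X Q)"
        by (simp add: h_simps R(4))
      then have "c = - t"
        by (simp only: mult_right_cancel[OF PQ])
      have "R = c *s X P + t *s X P"
        using eq by (simp only: diff_eq_eq)
      also have "\<dots> = 0"
        by (simp only: \<open>c = - t\<close> vec.scale_left_distrib[symmetric]) simp
      finally show False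
        using R(1) by contradiction
    qed
    have "proj_pt ?Y \<notin> S"
    proof
      assume in_S: "proj_pt ?Y \<in> S"
      have "h ?Y (X P) = 0"
        by (simp add: h_simps R(3) X_isotropic[OF P])
      then have "herm_collinear q (proj_pt ?Y) P"
        by (simp only: herm_collinear_iff[OF P])
      then have "proj_pt ?Y = P"
        using S_not_collinear in_S P by blast
      moreover have "?Y \<in> proj_pt ?Y"
        unfolding proj_pt_def by (intro vec.span_base) simp
      ultimately have "?Y \<in> proj_pt (X P)"
        by (simp only: proj_pt_X[OF P])
      then show False
        using not_multiple unfolding proj_pt_eq by blast
    qed
    moreover have "h ?Y ?Y = 0"
      by (simp add: h_simps R(2,3) PR X_isotropic[OF P])
    moreover have "?Y \<noteq> 0"
      using not_multiple[of 0] by simp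
    ultimately have "card {T \<in> S. h ?Y (X T) = 0} \<in> {0, 2}"
      by (intro card_orthogonal_in_S)
    moreover have "P \<in> {T \<in> S. h ?Y (X T) = 0}"
      by (simp add: h_simps P R(3) X_isotropic[OF P])
    then have "card {T \<in> S. h ?Y (X T) = 0} > 0"
      by (intro card_gt_0_iff[THEN iffD2] conjI) (blast, simp)
    ultimately show ?thesis
      by (elim insertE emptyE) (simp_all only: less_irrefl)
  qed
  have iff: "h (R - t *s X P) (X T) = 0 \<longleftrightarrow> h R (X T) / h (X P) (X T) = t" if "T \<in> S - {P}" for t T
  proof -
    have "h (X P) (X T) \<noteq> 0"
      using X_not_orthogonal[OF P, of T] that by blast
    then show ?thesis
      by (simp add: h_simps divide_eq_eq)
  qed
  have P_in: "P \<in> {T \<in> S. h (R - t *s X P) (X T) = 0}" for t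
    by (simp add: h_simps P R(3) X_isotropic[OF P])
  let ?f = "\<lambda>T. h R (X T) / h (X P) (X T)"
  have unique: "\<exists>T. {T. T \<in> S - {P} \<and> ?f T = t} = {T}" for t
  proof -
    have "card ({T \<in> S. h (R - t *s X P) (X T) = 0} - {P}) = 1"
      using two[of t] P_in[of t] by simp
    moreover have "{T \<in> S. h (R - t *s X P) (X T) = 0} - {P} = {T. T \<in> S - {P} \<and> ?f T = t}"
      using iff by blast
    ultimately have "card {T. T \<in> S - {P} \<and> ?f T = t} = 1"
      by (simp only:)
    then show ?thesis
      by (simp only: card_1_singleton_iff One_nat_def)
  qed
  show ?thesis
  proof (rule bij_betwI')
    show "?f T = ?f T' \<longleftrightarrow> T = T'" if "T \<in> S - {P}" "T' \<in> S - {P}" for T T'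
    proof
      obtain U where U: "{T. T \<in> S - {P} \<and> ?f T = ?f T'} = {U}"
        using unique[of "?f T'"] by (rule exE)
      assume "?f T = ?f T'"
      then have "T \<in> {U}" "T' \<in> {U}"
        unfolding U[symmetric] using that by simp_all
      then show "T = T'"
        by simp
    qed simp
    show "\<exists>T\<in>S - {P}. t = ?f T" for t
    proof -
      obtain U where U: "{T. T \<in> S - {P} \<and> ?f T = t} = {U}"
        using unique[of t] by (rule exE)
      have "U \<in> {U}"
        by simp
      then have "U \<in> {T. T \<in> S - {P} \<and> ?f T = t}"
        by (simp only: U)
      then show ?thesis
        by (intro bexI[of _ U]) auto
    qed
  qed simp
qed

text \<open>
  The product of the bijection of the previous lemma over its nonzero values; the value 0 is taken at
  \<open>Q\<close>.
\<close>
lemma prod_tangent_line: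
  assumes P: "P \<in> S" and Q: "Q \<in> S" and "P \<noteq> Q"
    and R: "R \<noteq> 0" "h R R = 0" "h R (X P) = 0" "h R (X Q) = 0"
  shows "(\<Prod>T\<in>S - {P, Q}. h R (X T)) = \<Prod>(UNIV - {0}) * (\<Prod>T\<in>S - {P, Q}. h (X P) (X T))"
proof -
  let ?f = "\<lambda>T. h R (X T) / h (X P) (X T)"
  have "bij_betw ?f (S - {P} - {Q}) (UNIV - {0})"
    using bij_betw_tangent_line[OF assms] R(4) Q \<open>P \<noteq> Q\<close>
    by (intro bij_betw_DiffI) (auto simp: bij_betw_def)
  moreover have "S - {P} - {Q} = S - {P, Q}"
    by blast
  ultimately have "(\<Prod>T\<in>S - {P, Q}. ?f T) = \<Prod>(UNIV - {0})"
    using prod.reindex_bij_betw[of ?f "S - {P, Q}" "UNIV - {0}" "\<lambda>x. x"] by (simp only:)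
  moreover have "(\<Prod>T\<in>S - {P, Q}. h R (X T)) = (\<Prod>T\<in>S - {P, Q}. ?f T * h (X P) (X T))"
    using X_not_orthogonal[OF P] by (intro prod.cong) auto
  ultimately show ?thesis
    by (simp only: prod.distrib)
qed

text \<open>
  The previous lemma applies to \<open>R\<close> on the lines through \<open>P\<close> and through \<open>Q\<close>, with the same left-hand
  side and the same constant.
\<close>
lemma prod_remaining_eq:
  assumes "P \<in> S" "Q \<in> S" "P \<noteq> Q"
  shows "(\<Prod>T\<in>S - {P, Q}. h (X P) (X T)) = (\<Prod>T\<in>S - {P, Q}. h (X Q) (X T))"
proof -
  obtain R where R: "R \<noteq> 0" "h R R = 0" "h R (X P) = 0" "h R (X Q) = 0"
    using exists_isotropic_orthogonal_to_two by blast
  have swap: "S - {Q, P} = S - {P, Q}"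
    by blast
  have eq: "\<Prod>(UNIV - {0::'a}) * (\<Prod>T\<in>S - {P, Q}. h (X P) (X T)) =
      \<Prod>(UNIV - {0}) * (\<Prod>T\<in>S - {P, Q}. h (X Q) (X T))"
    using prod_tangent_line[OF assms R]
      prod_tangent_line[OF assms(2,1) assms(3)[symmetric] R(1,2,4,3), unfolded swap] by (simp only:)
  have nonzero: "\<Prod>(UNIV - {0::'a}) \<noteq> 0"
    by (simp add: prod_zero_iff)
  show ?thesis
    using eq unfolding mult_left_cancel[OF nonzero] .
qed

text \<open>
  The ratio \<open>h (X P) (X Q) / h (X Q) (X P)\<close> is a quotient \<open>A P / A Q\<close>, so the product of three such
  ratios around a triangle telescopes. The equation is stated without division.
\<close>
lemma segre_invariant_trivial:
  assumes "P \<in> S" "Q \<in> S" "R \<in> S" and "P \<noteq> Q" "Q \<noteq> R" "P \<noteq> R"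
  shows "h (X P) (X Q) * h (X Q) (X R) * h (X R) (X P) =
    h (X Q) (X P) * h (X R) (X Q) * h (X P) (X R)"
proof -
  define A where "A = (\<lambda>P. \<Prod>T\<in>S - {P}. h (X P) (X T))"
  have A_nonzero: "A P \<noteq> 0" if "P \<in> S" for P
    using X_not_orthogonal[OF that] by (auto simp: A_def)
  have A_split: "A P = h (X P) (X Q) * (\<Prod>T\<in>S - {P, Q}. h (X P) (X T))"
    if "P \<in> S" "Q \<in> S" "P \<noteq> Q" for P Q
  proof -
    have "S - {P, Q} = (S - {P}) - {Q}"
      by blast
    then show ?thesis
      unfolding A_def using prod.remove[of "S - {P}" Q "\<lambda>T. h (X P) (X T)"] that by simp
  qed
  have ratio: "h (X P) (X Q) * A Q = h (X Q) (X P) * A P" if "P \<in> S" "Q \<in> S" "P \<noteq> Q" for P Q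
  proof -
    have "S - {Q, P} = S - {P, Q}"
      by blast
    then show ?thesis
      using A_split[OF that] A_split[OF that(2,1) that(3)[symmetric]] prod_remaining_eq[OF that]
      by (simp only: ac_simps)
  qed
  have "(h (X P) (X Q) * h (X Q) (X R) * h (X R) (X P)) * (A P * A Q * A R) =
      (h (X P) (X Q) * A Q) * (h (X Q) (X R) * A R) * (h (X R) (X P) * A P)"
    by (simp only: ac_simps)
  also have "\<dots> = (h (X Q) (X P) * A P) * (h (X R) (X Q) * A Q) * (h (X P) (X R) * A R)"
    by (simp only: ratio[OF assms(1,2,4)] ratio[OF assms(2,3,5)] ratio[OF assms(3,1) assms(6)[symmetric]])
  also have "\<dots> = (h (X Q) (X P) * h (X R) (X Q) * h (X P) (X R)) * (A P * A Q * A R)"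
    by (simp only: ac_simps)
  finally have eq: "(h (X P) (X Q) * h (X Q) (X R) * h (X R) (X P)) * (A P * A Q * A R) =
      (h (X Q) (X P) * h (X R) (X Q) * h (X P) (X R)) * (A P * A Q * A R)" .
  have nonzero: "A P * A Q * A R \<noteq> 0"
    using A_nonzero assms(1-3) by simp
  show ?thesis
    using eq unfolding mult_right_cancel[OF nonzero] .
qed

end

section \<open>The special set in a Baer subgeometry\<close>

text \<open>
  \<open>E\<close> is the point that plays the role of \<open>(0, 0, 0, 1)\<close> in the Veronesean, and \<open>Z\<close> that of
  \<open>(1, 0, 0, 0)\<close>.
\<close>
locale normalised_special_set = special_set_representatives q field_type S X
  for q :: nat and field_type :: "'a::{field,finite} itself"
    and S :: "('a ^ 4) set set" and X :: "('a ^ 4) set \<Rightarrow> 'a ^ 4" +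
  fixes E Z :: "('a ^ 4) set"
  assumes E_in: "E \<in> S" and Z_in: "Z \<in> S - {E}"
    and normalised: "P \<in> S - {E} \<Longrightarrow> h (X P) (X E) = 1"
begin

lemma h_X_E:
  assumes "P \<in> S - {E}"
  shows "h (X P) (X E) = 1" "h (X E) (X P) = 1"
  using normalised[OF assms] h_conj[of "X E" "X P"] by simp_all

text \<open>
  With \<open>E\<close> as third point, the other two factors on either side of the Segre identity are 1.
\<close>
lemma gram_symmetric:
  assumes "P \<in> S - {E}" "Q \<in> S - {E}"
  shows "h (X P) (X Q) = h (X Q) (X P)"
proof (cases "P = Q")
  case False
  have "h (X P) (X Q) * h (X Q) (X E) * h (X E) (X P) = h (X Q) (X P) * h (X E) (X Q) * h (X P) (X E)"
    using assms E_in False by (intro segre_invariant_trivial) auto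
  then show ?thesis
    by (simp add: h_X_E[OF assms(1)] h_X_E[OF assms(2)])
qed simp

lemma gram_fixed:
  assumes "P \<in> S - {E}" "Q \<in> S - {E}"
  shows "h (X P) (X Q) ^ q = h (X P) (X Q)"
  using gram_symmetric[OF assms] h_conj[of "X Q" "X P"] by simp

text \<open>
  For \<open>P \<noteq> E\<close> this is the component of \<open>X P\<close> orthogonal to the hyperbolic pair \<open>X Z, X E\<close>: the
  coefficient \<open>h (X P) (X E)\<close> of \<open>X Z\<close> is 1 by the normalisation.
\<close>
definition w :: "('a ^ 4) set \<Rightarrow> 'a ^ 4" where
  "w P = X P - X Z - h (X P) (X Z) *s X E"

lemma h_EE: "h (X E) (X E) = 0" and h_ZZ: "h (X Z) (X Z) = 0"
  and h_ZE: "h (X Z) (X E) = 1" and h_EZ: "h (X E) (X Z) = 1"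
  using X_isotropic[OF E_in] X_isotropic[of Z] Z_in h_X_E[OF Z_in] by blast+

lemma w_Z: "w Z = 0"
  by (simp add: w_def h_ZZ)

lemma w_orthogonal:
  assumes "P \<in> S - {E}"
  shows "h (w P) (X E) = 0" "h (w P) (X Z) = 0" "h (X E) (w P) = 0" "h (X Z) (w P) = 0"
proof -
  show "h (w P) (X E) = 0" "h (w P) (X Z) = 0"
    by (simp_all add: w_def h_simps h_X_E[OF assms] h_ZE h_EE h_EZ h_ZZ)
  then show "h (X E) (w P) = 0" "h (X Z) (w P) = 0"
    by (simp_all only: h_eq_0_commute[of "w P"])
qed

lemma h_w:
  assumes "P \<in> S - {E}" "Q \<in> S - {E}"
  shows "h (w P) (w Q) = h (X P) (X Q) - h (X P) (X Z) - h (X Q) (X Z)"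
proof -
  have "h (w P) (w Q) = h (w P) (X Q)"
    unfolding w_def[of Q] by (simp add: h_simps w_orthogonal[OF assms(1)])
  then show ?thesis
    by (simp add: w_def h_simps h_X_E[OF assms(2)] gram_symmetric[OF Z_in assms(2)])
qed

lemma h_w_fixed:
  assumes "P \<in> S - {E}" "Q \<in> S - {E}"
  shows "h (w P) (w Q) ^ q = h (w P) (w Q)"
  using gram_fixed assms Z_in by (simp only: h_w conj_diff)

lemma h_w_self:
  assumes "P \<in> S - {E}"
  shows "h (w P) (w P) = - 2 * h (X P) (X Z)"
  using X_isotropic[of P] assms by (simp add: h_w)

text \<open>
  Isotropy of the vectors \<open>X P\<close> and \<open>X Q\<close> turns the norm of the difference into \<open>- 2 * h (X P) (X Q)\<close>.
\<close>
lemma w_differences_anisotropic: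
  assumes "P \<in> S - {E}" "Q \<in> S - {E}" "P \<noteq> Q"
  shows "h (w P - w Q) (w P - w Q) \<noteq> 0"
proof -
  have "h (w P - w Q) (w P - w Q) = h (w P) (w P) + h (w Q) (w Q) - h (w P) (w Q) - h (w Q) (w P)"
    by (simp add: h_simps)
  also have "\<dots> = - 2 * h (X P) (X Q)"
    by (simp only: h_w_self[OF assms(1)] h_w_self[OF assms(2)] h_w[OF assms(1,2)] h_w[OF assms(2,1)]
        gram_symmetric[OF assms(2,1)]) simp
  finally show ?thesis
    using X_not_orthogonal[of P Q] assms by simp
qed

lemma inj_w: "inj_on w (S - {E})"
proof (rule inj_onI, rule ccontr)
  fix P Q assume "P \<in> S - {E}" "Q \<in> S - {E}" "w P = w Q" "P \<noteq> Q"
  then show False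
    using w_differences_anisotropic[of P Q] by (simp add: h_simps)
qed

lemma card_affine_part: "card (S - {E}) = q\<^sup>2"
  using E_in by (simp add: card_S)

lemma q_less_q2: "q < q\<^sup>2"
  using q_gt_1 by (simp add: power2_eq_square)

text \<open>
  The counting argument used twice below: \<open>S - {E}\<close> has \<open>q\<^sup>2\<close> points, the fixed field at most \<open>q\<close>
  elements.
\<close>
lemma no_injection_into_fixed_field:
  assumes "inj_on f (S - {E})" "f ` (S - {E}) \<subseteq> {x :: 'a. x ^ q = x}"
  shows False
proof -
  have "card (S - {E}) \<le> card {x :: 'a. x ^ q = x}"
    by (rule card_inj_on_le[OF assms]) simp
  then show False
    using card_fixed_field card_affine_part q_less_q2 by linarith
qed

text \<open>
  Some \<open>w P2\<close> is not a multiple of \<open>u1 = w P1\<close>, because the multiples that occur have fixed coefficients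
  and there are too few of these. Orthogonalising gives \<open>u2\<close>. Since the pairings of any \<open>w P\<close> with \<open>w P1\<close> and
  \<open>w P2\<close> are fixed by conjugation, so are its coordinates with respect to \<open>u1, u2\<close>.
\<close>
lemma orthogonal_basis:
  obtains u1 u2 where "h u1 u1 \<noteq> 0" "h u2 u2 \<noteq> 0" "h u1 u2 = 0" "h u2 u1 = 0"
    and "\<And>u. u \<in> {u1, u2} \<Longrightarrow> h u (X Z) = 0 \<and> h (X Z) u = 0 \<and> h u (X E) = 0 \<and> h (X E) u = 0"
    and "\<And>P. P \<in> S - {E} \<Longrightarrow> \<exists>a b. a ^ q = a \<and> b ^ q = b \<and> w P = a *s u1 + b *s u2"
proof -
  have "card (S - {E} - {Z}) > 0"
    using Z_in card_affine_part q_less_q2 q_gt_1 by (simp add: card_Diff_singleton)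
  then obtain P1 where P1: "P1 \<in> S - {E}" "P1 \<noteq> Z"
    by (metis Diff_iff card_gt_0_iff ex_in_conv singletonI)
  define u1 where "u1 = w P1"
  have D1: "h u1 u1 \<noteq> 0"
    using w_differences_anisotropic[OF P1(1) Z_in P1(2)] by (simp add: w_Z u1_def)
  have D1_fixed: "h u1 u1 ^ q = h u1 u1"
    by (rule h_self_fixed)
  have "\<exists>P2\<in>S - {E}. w P2 \<noteq> (h (w P2) u1 / h u1 u1) *s u1"
  proof (rule ccontr)
    assume "\<not> ?thesis"
    then have multiple: "w P = (h (w P) u1 / h u1 u1) *s u1" if "P \<in> S - {E}" for P
      using that by blast
    have "inj_on (\<lambda>P. h (w P) u1 / h u1 u1) (S - {E})"
    proof (rule inj_onI)
      fix P Q assume PQ: "P \<in> S - {E}" "Q \<in> S - {E}"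
        and eq: "h (w P) u1 / h u1 u1 = h (w Q) u1 / h u1 u1"
      have "w P = (h (w Q) u1 / h u1 u1) *s u1"
        using multiple[OF PQ(1)] by (simp only: eq)
      also have "\<dots> = w Q"
        by (rule multiple[OF PQ(2), symmetric])
      finally show "P = Q"
        using inj_onD[OF inj_w _ PQ] by blast
    qed
    moreover have "(\<lambda>P. h (w P) u1 / h u1 u1) ` (S - {E}) \<subseteq> {x. x ^ q = x}"
    proof (rule image_subsetI)
      fix P assume "P \<in> S - {E}"
      then show "h (w P) u1 / h u1 u1 \<in> {x. x ^ q = x}"
        using h_w_fixed[OF _ P1(1)] D1_fixed unfolding u1_def by (simp only: power_divide mem_Collect_eq)
    qed
    ultimately show False
      by (rule no_injection_into_fixed_field)
  qed
  then obtain P2 where P2: "P2 \<in> S - {E}" "w P2 \<noteq> (h (w P2) u1 / h u1 u1) *s u1"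
    by blast
  define c where "c = h (w P2) u1 / h u1 u1"
  have c_fixed: "c ^ q = c"
    unfolding c_def using h_w_fixed[OF P2(1) P1(1)] D1_fixed by (simp add: power_divide u1_def)
  define u2 where "u2 = w P2 - c *s u1"
  have "u2 \<noteq> 0"
    using P2(2) by (simp add: u2_def c_def)
  have u2_u1: "h u2 u1 = 0"
    using D1 by (simp add: u2_def h_simps c_def)
  have u1_u2: "h u1 u2 = 0"
    using u2_u1 by (rule h_eq_0_commute[THEN iffD1])
  have u1_orth: "h u1 (X Z) = 0" "h (X Z) u1 = 0" "h u1 (X E) = 0" "h (X E) u1 = 0"
    using w_orthogonal[OF P1(1)] by (simp_all add: u1_def)
  have u2_orth: "h u2 (X Z) = 0" "h (X Z) u2 = 0" "h u2 (X E) = 0" "h (X E) u2 = 0"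
    by (simp_all add: u2_def h_simps w_orthogonal[OF P2(1)] u1_orth)
  have D2: "h u2 u2 \<noteq> 0"
    using orthogonal_complement_anisotropic[OF h_ZZ h_EE h_ZE h_EZ u1_orth(1) u2_orth(1) u1_orth(3)
        u2_orth(3) u1_orth(2,4) u2_u1 D1 \<open>u2 \<noteq> 0\<close>] .
  have expand: "\<exists>a b. a ^ q = a \<and> b ^ q = b \<and> w P = a *s u1 + b *s u2" if P: "P \<in> S - {E}" for P
  proof (intro exI conjI)
    show "w P = (h (w P) u1 / h u1 u1) *s u1 + (h (w P) u2 / h u2 u2) *s u2"
      using orthogonal_expansion[OF h_ZZ h_EE h_ZE h_EZ u1_orth(1) u2_orth(1) u1_orth(3)
        u2_orth(3) u1_orth(2,4) u2_u1 D1 \<open>u2 \<noteq> 0\<close> u1_u2 u2_orth(2,4) w_orthogonal(2)[OF P]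
        w_orthogonal(1)[OF P]] .
    show "(h (w P) u1 / h u1 u1) ^ q = h (w P) u1 / h u1 u1"
      using h_w_fixed[OF P P1(1)] D1_fixed by (simp add: power_divide u1_def)
    have "h (w P) u2 = h (w P) (w P2) - c * h (w P) (w P1)"
      by (simp add: u2_def u1_def h_simps c_fixed)
    then have "h (w P) u2 ^ q = h (w P) u2"
      by (simp add: conj_diff power_mult_distrib c_fixed h_w_fixed[OF P P1(1)] h_w_fixed[OF P P2(1)])
    then show "(h (w P) u2 / h u2 u2) ^ q = h (w P) u2 / h u2 u2"
      by (simp add: power_divide h_self_fixed)
  qed
  show thesis
    by (rule that[of u1 u2]) (use D1 D2 u1_u2 u2_u1 u1_orth u2_orth expand in auto)
qed

lemma frame_map_vector:
  "frame_map A B C D (vector [a, b, c, d]) = a *s A + b *s B + c *s C + d *s D"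
  using vector_4_nth[of a b c d "vector [a, b, c, d]"] by (simp add: frame_map_def)

text \<open>
  The similarity takes \<open>(0, 0, 0, 1)\<close> to a multiple of \<open>X E\<close>, and \<open>(1, x, x ^ q, x ^ (q + 1))\<close> to
  \<open>X P\<close>, where \<open>x = a P + b P * z\<close> comes from the coordinates of \<open>w P\<close>. This shows that every point of \<open>S\<close> is reached, and the Veronesean has at most
  \<open>q\<^sup>2 + 1 = card S\<close> points.
\<close>
lemma similarity_from_veronesean:
  "\<exists>T. similarity T \<and> image T ` herm_veronesean q = S"
proof -
  obtain u1 u2 where D: "h u1 u1 \<noteq> 0" "h u2 u2 \<noteq> 0" and u12: "h u1 u2 = 0" "h u2 u1 = 0"
    and orth: "\<And>u. u \<in> {u1, u2} \<Longrightarrow> h u (X Z) = 0 \<and> h (X Z) u = 0 \<and> h u (X E) = 0 \<and> h (X E) u = 0"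
    and expand: "\<And>P. P \<in> S - {E} \<Longrightarrow> \<exists>a b. a ^ q = a \<and> b ^ q = b \<and> w P = a *s u1 + b *s u2"
    using orthogonal_basis by metis
  have "(- (h u2 u2 / h u1 u1)) ^ q = - (h u2 u2 / h u1 u1)"
    by (simp only: conj_minus power_divide h_self_fixed)
  then obtain z where z: "z\<^sup>2 = - (h u2 u2 / h u1 u1)"
    using fixed_is_square by blast
  have z_nonzero: "z \<noteq> 0"
    using z D by auto
  have D2: "h u2 u2 = - z\<^sup>2 * h u1 u1"
    using z D by (simp add: field_simps)
  have h_comb: "h (a *s u1 + b *s u2) (a *s u1 + b *s u2) = h u1 u1 * (a + b * z) * (a - b * z)"
    if "a ^ q = a" "b ^ q = b" for a b
    using that by (simp add: h_simps u12 D2 algebra_simps power2_eq_square)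
  obtain a b where ab: "\<And>P. P \<in> S - {E} \<Longrightarrow> a P ^ q = a P \<and> b P ^ q = b P \<and> w P = a P *s u1 + b P *s u2"
    using expand by metis
  \<comment> \<open>By \<open>h_comb\<close> and anisotropy of differences the values \<open>a P + b P * z\<close> are pairwise distinct; with \<open>z\<close> fixed
    by conjugation they would all lie in the fixed field, which is too small.\<close>
  have z_conj: "z ^ q = - z"
  proof (rule ccontr)
    assume "z ^ q \<noteq> - z"
    moreover have "(z ^ q)\<^sup>2 = z\<^sup>2"
      by (metis \<open>(- (h u2 u2 / h u1 u1)) ^ q = - (h u2 u2 / h u1 u1)\<close> power_commutes power_mult mult.commute z)
    ultimately have zq: "z ^ q = z"
      by (simp add: power2_eq_iff)
    have "inj_on (\<lambda>P. a P + b P * z) (S - {E})"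
    proof (rule inj_onI, rule ccontr)
      fix P Q assume PQ: "P \<in> S - {E}" "Q \<in> S - {E}" "a P + b P * z = a Q + b Q * z" "P \<noteq> Q"
      have "w P - w Q = (a P - a Q) *s u1 + (b P - b Q) *s u2"
        using ab[OF PQ(1)] ab[OF PQ(2)] by (simp add: vec_eq_iff algebra_simps)
      moreover have "(a P - a Q) + (b P - b Q) * z = 0"
        using PQ(3) by (simp add: algebra_simps)
      moreover have "(a P - a Q) ^ q = a P - a Q" "(b P - b Q) ^ q = b P - b Q"
        using ab[OF PQ(1)] ab[OF PQ(2)] by (simp_all add: conj_diff)
      ultimately have "h (w P - w Q) (w P - w Q) = 0"
        by (simp only: h_comb) simp
      then show False
        using w_differences_anisotropic PQ by blast
    qed
    moreover have "(\<lambda>P. a P + b P * z) ` (S - {E}) \<subseteq> {x. x ^ q = x}"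
    proof (rule image_subsetI)
      fix P assume "P \<in> S - {E}"
      then show "a P + b P * z \<in> {x. x ^ q = x}"
        using ab[of P] zq by (simp add: conj_add power_mult_distrib)
    qed
    ultimately show False
      by (rule no_injection_into_fixed_field)
  qed
  \<comment> \<open>\<open>f1\<close> and \<open>f2\<close> solve \<open>f1 + f2 = u1\<close> and \<open>z *s (f1 - f2) = u2\<close>, so that \<open>a u1 + b u2 = x f1 + x ^ q f2\<close>
    for \<open>x = a + b z\<close>, whose conjugate is \<open>a - b z\<close>; their norm is \<open>h u1 u1 / 2 = - m\<close>.\<close>
  define m where "m = - h u1 u1 / 2"
  define f1 where "f1 = (1 / 2) *s (u1 + (1 / z) *s u2)"
  define f2 where "f2 = (1 / 2) *s (u1 - (1 / z) *s u2)"
  have halves: "(1 / 2) * (x + y) + (1 / 2) * (x - y) = x" "(1 / 2) * (x + y) - (1 / 2) * (x - y) = y" for x y :: 'a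
  proof -
    have "(1 / 2) * (x + y) + (1 / 2) * (x - y) = (1 / 2) * (2 * x)"
      by (simp only: distrib_left[symmetric]) simp
    then show "(1 / 2) * (x + y) + (1 / 2) * (x - y) = x"
      by simp
    have "(1 / 2) * (x + y) - (1 / 2) * (x - y) = (1 / 2) * (2 * y)"
      by (simp only: right_diff_distrib[symmetric]) simp
    then show "(1 / 2) * (x + y) - (1 / 2) * (x - y) = y"
      by simp
  qed
  have u1_eq: "u1 = f1 + f2"
    unfolding f1_def f2_def vec_eq_iff vector_add_component vector_minus_component
      vector_smult_component halves by simp
  have u2_eq: "u2 = z *s (f1 - f2)"
    unfolding f1_def f2_def vec_eq_iff vector_add_component vector_minus_component
      vector_smult_component halves using z_nonzero by simp
  have f_orth: "h f (X Z) = 0" "h (X Z) f = 0" "h f (X E) = 0" "h (X E) f = 0" if "f \<in> {f1, f2}" for f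
  proof -
    have "f = f1 \<or> f = f2"
      using that by simp
    then show "h f (X Z) = 0" "h (X Z) f = 0" "h f (X E) = 0" "h (X E) f = 0"
      using orth[of u1] orth[of u2] by (auto simp: f1_def f2_def h_simps)
  qed
  have conj_coeffs: "(1 / 2 :: 'a) ^ q = 1 / 2" "(1 / z) ^ q = - (1 / z)"
    by (simp_all add: power_divide z_conj)
  have four: "(4 :: 'a) = 2 * 2"
    by simp
  have four_neq_0: "(4 :: 'a) \<noteq> 0"
    unfolding four by (simp only: mult_eq_0_iff two_neq_0 simp_thms)
  have h_halves: "h ((1 / 2) *s (u1 + s *s u2)) ((1 / 2) *s (u1 + t *s u2)) =
      (h u1 u1 + s * t ^ q * h u2 u2) / 4" for s t
    by (simp only: h_simps u12 conj_coeffs) (simp add: field_simps four_neq_0)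
  have f2_alt: "f2 = (1 / 2) *s (u1 + (- (1 / z)) *s u2)"
    by (simp add: f2_def)
  have f11: "h f1 f1 = - m" and f22: "h f2 f2 = - m" and f12: "h f1 f2 = 0"
    unfolding f1_def f2_alt h_halves using z_nonzero four_neq_0
    by (simp_all add: conj_minus z_conj D2 m_def field_simps power2_eq_square)
  have f21: "h f2 f1 = 0"
    using f12 by (rule h_eq_0_commute[THEN iffD1])
  have m: "m ^ q = m" "m \<noteq> 0"
    using D by (simp_all add: m_def power_divide conj_minus h_self_fixed)
  define T where "T = frame_map (X Z) f1 f2 (m *s X E)"
  have sim: "similarity T"
    unfolding T_def by (rule similarity_frame_map) (simp_all add: h_ZZ h_EE h_ZE h_EZ f_orth f11 f22 f12 f21 m)
  have "S \<subseteq> image T ` herm_veronesean q"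
  proof
    fix P assume P: "P \<in> S"
    show "P \<in> image T ` herm_veronesean q"
    proof (cases "P = E")
      case True
      have "T (vector [0, 0, 0, 1]) = m *s X E"
        by (simp add: T_def frame_map_vector)
      moreover have "proj_pt (m *s X E) = proj_pt (X E)"
        using m(2) unfolding proj_pt_def by (simp add: vec.span_image_scale[of "{X E}" "\<lambda>_. m", simplified])
      ultimately have "P = T ` proj_pt (vector [0, 0, 0, 1])"
        using proj_pt_X[OF E_in] True by (simp add: similarity_image_proj_pt[OF sim])
      then show ?thesis
        unfolding herm_veronesean_def by blast
    next
      case False
      with P have P': "P \<in> S - {E}"
        by simp
      define x where "x = a P + b P * z"
      have xq: "x ^ q = a P - b P * z"
        using ab[OF P'] by (simp add: x_def conj_add power_mult_distrib z_conj)
      have "w P = x *s f1 + x ^ q *s f2"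
      proof -
        have "w P = a P *s (f1 + f2) + b P *s (z *s (f1 - f2))"
          using ab[OF P'] u1_eq u2_eq by simp
        then show ?thesis
          unfolding xq by (simp add: x_def vec_eq_iff algebra_simps)
      qed
      moreover have "x ^ (q + 1) * m = h (X P) (X Z)"
      proof -
        have "h (w P) (w P) = h u1 u1 * x * x ^ q"
          using ab[OF P'] h_comb[of "a P" "b P"] by (simp add: x_def xq[unfolded x_def])
        then have norm: "h u1 u1 * (x * x ^ q) = - 2 * h (X P) (X Z)"
          using h_w_self[OF P'] by simp
        have "x ^ (q + 1) * m = - (h u1 u1 * (x * x ^ q)) / 2"
          by (simp add: m_def)
        also have "\<dots> = h (X P) (X Z)"
          by (simp only: norm) simp
        finally show ?thesis .
      qed
      ultimately have "T (vector [1, x, x ^ q, x ^ (q + 1)]) = X P"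
        by (simp add: T_def frame_map_vector w_def vec.scale_scale diff_eq_eq algebra_simps)
      then have "P = T ` proj_pt (vector [1, x, x ^ q, x ^ (q + 1)])"
        using proj_pt_X[OF P] by (simp only: similarity_image_proj_pt[OF sim])
      then show ?thesis
        unfolding herm_veronesean_def by blast
    qed
  qed
  moreover have "finite (herm_veronesean q :: ('a ^ 4) set set)"
    by simp
  moreover have "card (image T ` herm_veronesean q) \<le> card S"
  proof -
    define g where "g x = proj_pt (vector [1, x, x ^ q, x ^ (q + 1)] :: 'a ^ 4)" for x :: 'a
    have "(herm_veronesean q :: ('a ^ 4) set set) = insert (proj_pt (vector [0, 0, 0, 1])) (range g)"
      unfolding herm_veronesean_def g_def by blast
    then have "card (herm_veronesean q :: ('a ^ 4) set set) \<le> Suc (card (range g))"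
      by (simp only: card_insert_if finite) simp
    moreover have "card (range g) \<le> q\<^sup>2"
      using card_image_le[of UNIV g] card_field by simp
    moreover have "card (image T ` herm_veronesean q) \<le> card (herm_veronesean q :: ('a ^ 4) set set)"
      by (rule card_image_le) simp
    ultimately show ?thesis
      unfolding card_S by linarith
  qed
  ultimately have "S = image T ` herm_veronesean q"
    by (intro card_seteq) simp_all
  then show ?thesis
    using sim by blast
qed

end

text \<open>
  Scaling arbitrary representatives by \<open>inverse (h (Y P) (Y E))\<close> produces the normalised ones. The similarity
  maps the Veronesean onto \<open>S\<close>, so its inverse is the required collineation.
\<close>
theorem theorem1p1:
  fixes q :: nat and S :: "('a::{field,finite} ^ 4) set set"
  assumes "primepow q" and "odd q"
    and "CARD('a) = q\<^sup>2"
    and "special_set q S"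
  shows "projectively_equivalent q S (herm_veronesean q)"
proof -
  interpret hermitian_geometry q "TYPE('a)"
    using assms(1-3) by unfold_locales
  have S_points: "S \<subseteq> pg_points"
    using assms(4) unfolding special_set_def herm_surface_def by blast
  define Y where "Y P = (SOME v. v \<noteq> 0 \<and> proj_pt v = P)" for P :: "('a ^ 4) set"
  have Y: "Y P \<noteq> 0 \<and> proj_pt (Y P) = P" if "P \<in> S" for P
  proof -
    have "\<exists>v. v \<noteq> 0 \<and> proj_pt v = P"
      using that S_points unfolding pg_points_eq by blast
    then show ?thesis
      unfolding Y_def by (rule someI_ex)
  qed
  interpret rep: special_set_representatives q "TYPE('a)" S Y
    using assms(4) Y by unfold_locales blast+
  have "\<not> card S \<le> Suc 0"
    using rep.card_S q_gt_1 by simp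
  then obtain E Z where EZ: "E \<in> S" "Z \<in> S" "E \<noteq> Z"
    unfolding card_le_Suc0_iff_eq[OF rep.finite_S] by blast
  define X where "X P = (if P = E then Y E else inverse (h (Y P) (Y E)) *s Y P)" for P
  have scale: "c *s v \<noteq> 0 \<and> proj_pt (c *s v) = proj_pt v" if "c \<noteq> 0" "v \<noteq> 0" for c and v :: "'a ^ 4"
    using that vec.span_image_scale[of "{v}" "\<lambda>_. c"] by (simp add: proj_pt_def)
  have X: "X P \<noteq> 0 \<and> proj_pt (X P) = P" if P: "P \<in> S" for P
  proof (cases "P = E")
    case False
    then have "inverse (h (Y P) (Y E)) \<noteq> 0"
      using rep.X_not_orthogonal[OF P EZ(1)] by simp
    then show ?thesis
      using scale Y[OF P] False by (simp add: X_def)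
  qed (use Y P in \<open>simp add: X_def\<close>)
  interpret normalised_special_set q "TYPE('a)" S X E Z
  proof unfold_locales
    show "special_set q S"
      by (rule assms(4))
    show "X P \<noteq> 0" "proj_pt (X P) = P" if "P \<in> S" for P
      using X[OF that] by simp_all
    show "E \<in> S" "Z \<in> S - {E}"
      using EZ by simp_all
    show "h (X P) (X E) = 1" if "P \<in> S - {E}" for P
      using that rep.X_not_orthogonal[of P E] EZ(1) by (simp add: X_def h_simps)
  qed
  show ?thesis
    using similarity_from_veronesean projectively_equivalentI by blast
qed

end
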